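(* Suppose $f:\mathbb{R}^n\to\mathbb{R}$ is twice continuously differentiable and satisfies the concordant second-order Lipschitz condition with constant $\beta>0$. In every outer iteration $k\ge1$ of the homotopy HSODM, the number of iterates $j$ in the inner iteration (generalized homogeneous models solved until the approximate centering condition holds) is upper bounded by $$\mathcal{T}:=\mathcal{T}_k=\left\lceil\log_2\left(\frac{\log(1+3(\beta+1))-\log(\beta+1)}{\log3-\log2}\right)\right\rceil\le2 .$$
   Context: Concordant second-order Lipschitz condition: there is a constant $\beta>0$ such that for any $x\in\operatorname{dom}(f)$, $\|\nabla f(x+d)-\nabla f(x)-\nabla^2f(x)d\|\le\beta\,d^T\nabla^2f(x)d$, where $d$ satisfies $\|d\|\le C$ for some $C>0$ and $x+d\in\operatorname{dom}(f)$. (Such $f$ is convex.) Homotopy HSODM. Notation $g_{k,j}=\nabla f(x_{k,j})$, $H_{k,j}=\nabla^2f(x_{k,j})$. Initialize $x_{0,0}=0$, $\mu_0=2(\beta+1)(1+\|g_{0,0}\|^2)$. For $k=0,1,\dots$: run the inner procedure from $x_{k,0}$ with $\mu_k$, obtaining $(x_{k,j},\rho_k)$; set $\mu_{k+1}=\rho_k\mu_k$ and $x_{k+1,0}=x_{k,j}$. Inner procedure: for $j=0,1,\dots$: if $\|g_{k,j}+\mu_kx_{k,j}\|\le\frac{\mu_k}{1+3(\beta+1)}$ (approximate centering condition), return $x_{k,j}$ and $\rho_k=\frac{3(\beta+1)(1+\|x_{k,j}\|)}{1+3(\beta+1)(1+\|x_{k,j}\|)}$; otherwise solve the generalized homogeneous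 model $$\min_{\|[v;t]\|\le1}\begin{bmatrix}v\\t\end{bmatrix}^T\begin{bmatrix}H_{k,j}&g_{k,j}+\mu_kx_{k,j}\\(g_{k,j}+\mu_kx_{k,j})^T&-\mu_k\end{bmatrix}\begin{bmatrix}v\\t\end{bmatrix}$$ with solution $[v_{k,j};t_{k,j}]$ and set $x_{k,j+1}=x_{k,j}+v_{k,j}/t_{k,j}$. *)

theory Defs
  imports "HOL-Analysis.Analysis"
begin

definition grad :: "(real^'n \<Rightarrow> real) \<Rightarrow> real^'n \<Rightarrow> real^'n" where
  "grad f x = (\<chi> i. frechet_derivative f (at x) (axis i 1))"

definition hess :: "(real^'n \<Rightarrow> real) \<Rightarrow> real^'n \<Rightarrow> real^'n^'n" where
  "hess f x = matrix (frechet_derivative (grad f) (at x))"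

definition twice_continuously_differentiable :: "(real^'n \<Rightarrow> real) \<Rightarrow> bool" where
  "twice_continuously_differentiable f \<longleftrightarrow>
     (\<forall>x. f differentiable (at x)) \<and> (\<forall>x. grad f differentiable (at x)) \<and>
     continuous_on UNIV (hess f)"

text \<open>The domain of \<open>f\<close> is all of \<open>\<real>\<^sup>n\<close>. The radius \<open>C\<close> may be arbitrarily
  small, but is uniform in \<open>x\<close>.\<close>

definition concordant_lipschitz :: "real \<Rightarrow> (real^'n \<Rightarrow> real) \<Rightarrow> bool" where
  "concordant_lipschitz \<beta> f \<longleftrightarrow> \<beta> > 0 \<and>
     (\<exists>C>0. \<forall>x d. norm d \<le> C \<longrightarrow>
        norm (grad f (x + d) - grad f x - hess f x *v d) \<le> \<beta> * (d \<bullet> (hess f x *v d)))"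

text \<open>The objective \<open>[v;t]\<^sup>T [H, g; g\<^sup>T, -\<mu>] [v;t]\<close>, with \<open>[v;t]\<close> encoded as a pair;
  the inner product and the norm on \<open>real^'n \<times> real\<close> are the Euclidean ones.\<close>

definition ghm_objective ::
  "real^'n^'n \<Rightarrow> real^'n \<Rightarrow> real \<Rightarrow> (real^'n) \<times> real \<Rightarrow> real" where
  "ghm_objective H g \<mu> = (\<lambda>(v, t). (v, t) \<bullet> (H *v v + t *\<^sub>R g, g \<bullet> v - \<mu> * t))"

definition ghm_solution ::
  "real^'n^'n \<Rightarrow> real^'n \<Rightarrow> real \<Rightarrow> real^'n \<Rightarrow> real \<Rightarrow> bool" where
  "ghm_solution H g \<mu> v t \<longleftrightarrow>
     is_arg_min (ghm_objective H g \<mu>) (\<lambda>z. norm z \<le> 1) (v, t)"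

definition approx_centered ::
  "real \<Rightarrow> (real^'n \<Rightarrow> real) \<Rightarrow> real \<Rightarrow> real^'n \<Rightarrow> bool" where
  "approx_centered \<beta> f \<mu> x \<longleftrightarrow> norm (grad f x + \<mu> *\<^sub>R x) \<le> \<mu> / (1 + 3 * (\<beta> + 1))"

definition homotopy_ratio :: "real \<Rightarrow> real^'n \<Rightarrow> real" where
  "homotopy_ratio \<beta> x =
     (3 * (\<beta> + 1) * (1 + norm x)) / (1 + 3 * (\<beta> + 1) * (1 + norm x))"

text \<open>The inner procedure with parameter \<open>\<mu>\<close> and iterates \<open>y 0, y 1, \<dots>\<close> returns at
  \<open>j\<close>, after having solved exactly \<open>j\<close> homogeneous models.\<close>

definition inner_returns_at ::
  "real \<Rightarrow> (real^'n \<Rightarrow> real) \<Rightarrow> real \<Rightarrow> (nat \<Rightarrow> real^'n) \<Rightarrow> nat \<Rightarrow> bool" where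
  "inner_returns_at \<beta> f \<mu> y j \<longleftrightarrow>
     approx_centered \<beta> f \<mu> (y j) \<and> (\<forall>i<j. \<not> approx_centered \<beta> f \<mu> (y i))"

text \<open>An execution of the method; the solution \<open>[v k j; t k j]\<close> of each model may be any
  minimizer. Inner loops are not assumed to terminate: in an inner loop that never returns,
  the iterates are constrained for all \<open>j\<close>, and the start of the next outer iteration is left
  unspecified. Entries \<open>x k j\<close> beyond the returned index are unconstrained.\<close>

definition homotopy_hsodm_run ::
  "real \<Rightarrow> (real^'n \<Rightarrow> real) \<Rightarrow> (nat \<Rightarrow> nat \<Rightarrow> real^'n) \<Rightarrow> (nat \<Rightarrow> nat \<Rightarrow> real^'n) \<Rightarrow>
   (nat \<Rightarrow> nat \<Rightarrow> real) \<Rightarrow> (nat \<Rightarrow> real) \<Rightarrow> (nat \<Rightarrow> real) \<Rightarrow> bool" where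
  "homotopy_hsodm_run \<beta> f x v t \<mu> \<rho> \<longleftrightarrow>
     x 0 0 = 0 \<and> \<mu> 0 = 2 * (\<beta> + 1) * (1 + (norm (grad f (x 0 0)))\<^sup>2) \<and>
     (\<forall>k j. (\<forall>i\<le>j. \<not> approx_centered \<beta> f (\<mu> k) (x k i)) \<longrightarrow>
        ghm_solution (hess f (x k j)) (grad f (x k j) + \<mu> k *\<^sub>R x k j) (\<mu> k) (v k j) (t k j) \<and>
        x k (Suc j) = x k j + v k j /\<^sub>R t k j) \<and>
     (\<forall>k j. inner_returns_at \<beta> f (\<mu> k) (x k) j \<longrightarrow>
        \<rho> k = homotopy_ratio \<beta> (x k j) \<and> \<mu> (Suc k) = \<rho> k * \<mu> k \<and> x (Suc k) 0 = x k j)"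

end

theory Submission imports Defs begin

text \<open>
  Measure the distance of a point \<open>x\<close> from the central path by the scaled residual
  \<open>e = (\<beta> + 1) \<parallel>\<nabla>f(x) + \<mu> x\<parallel> / \<mu>\<close>. Solving one homogeneous model squares this quantity as long as
  \<open>e \<le> 2/3\<close> (\<open>centering_error_ghm_step\<close>), and the update of \<open>\<mu>\<close> between outer iterations is so
  mild that every outer iteration \<open>k \<ge> 1\<close> starts with \<open>e \<le> 2/3\<close>
  (\<open>centering_error_after_update\<close>). After two models \<open>e \<le> (2/3)\<^sup>4 < 1/4\<close>, while the approximate
  centering condition reads \<open>e \<le> (\<beta> + 1) / (1 + 3 (\<beta> + 1))\<close>, and the right-hand side exceeds
  \<open>1/4\<close>. The bound \<open>\<T>\<close> equals \<open>2\<close> for every \<open>\<beta> > 0\<close>, because \<open>1 + 3 (\<beta> + 1)\<close> over \<open>\<beta> + 1\<close>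
  lies between \<open>(3/2)\<^sup>2\<close> and \<open>(3/2)\<^sup>4\<close>. Outer iteration \<open>0\<close> matters too, since an inner loop that
  never returned would leave the later ones unspecified; the value of \<open>\<mu>\<^sub>0\<close> makes it return
  without solving any model.

  The squaring rests on the optimality conditions of the model. A solution \<open>[v; t]\<close> is an
  eigenvector for the lowest eigenvalue \<open>-\<theta> \<le> -\<mu>\<close>, so \<open>d = v/t\<close> is a regularized Newton step:
  \<open>(H + \<theta> I) d = -g\<close> and \<open>g \<bullet> d = \<mu> - \<theta>\<close>, where \<open>g\<close> is the residual. The new residual is
  therefore the Taylor error of the gradient minus \<open>(\<theta> - \<mu>) d\<close>. This uses that the Hessian is
  symmetric (\<open>hess_symmetric\<close>) and, by the Lipschitz condition itself, positive semidefinite.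

  The Lipschitz condition only speaks of steps of length at most \<open>C\<close>, which may be far shorter
  than \<open>d\<close>. It propagates to all lengths at the price of a factor \<open>exp (2 \<beta> \<parallel>d\<parallel>)\<close>
  (\<open>concordant_gradient_error\<close>): the curvature along a line grows at most exponentially. For the
  steps at hand \<open>2 \<beta> \<parallel>d\<parallel> \<le> 4/3\<close>, so the factor is below \<open>4\<close>, and it is absorbed by the bound
  \<open>d\<^sup>T H d \<le> \<parallel>g\<parallel>\<^sup>2 / (4 \<mu>)\<close>, which holds for regularized Newton steps.
\<close>

section \<open>Symmetry of the second derivative\<close>

lemma has_derivative_grad:
  assumes "f differentiable (at x)"
  shows "(f has_derivative (\<lambda>h. grad f x \<bullet> h)) (at x)"
proof -
  let ?D = "frechet_derivative f (at x)"
  have lin: "linear ?D" by (rule linear_frechet_derivative[OF assms])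
  have "?D h = grad f x \<bullet> h" for h
  proof -
    have "?D h = ?D (\<Sum>i\<in>UNIV. h $ i *\<^sub>R axis i 1)"
      by (metis basis_expansion scalar_mult_eq_scaleR)
    also have "\<dots> = (\<Sum>i\<in>UNIV. h $ i * ?D (axis i 1))"
      by (simp add: linear_sum[OF lin] linear_cmul[OF lin])
    also have "\<dots> = grad f x \<bullet> h"
      by (simp add: grad_def inner_vec_def mult.commute)
    finally show ?thesis .
  qed
  then have "?D = (\<lambda>h. grad f x \<bullet> h)" by auto
  with assms show ?thesis by (simp add: frechet_derivative_works)
qed

lemma has_derivative_hess:
  assumes "grad f differentiable (at x)"
  shows "(grad f has_derivative (\<lambda>h. hess f x *v h)) (at x)"
  using assms unfolding hess_def jacobian_works jacobian_def .

text \<open>The second difference \<open>f(x+u+v) - f(x+u) - f(x+v) + f(x)\<close> is symmetric in \<open>u\<close> and \<open>v\<close>,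
  and the mean value theorem in direction \<open>u\<close> identifies it with \<open>A v \<bullet> u\<close> up to a small error,
  when \<open>A\<close> is the derivative of the gradient \<open>G\<close>. Comparing both readings makes \<open>A\<close>
  self-adjoint.\<close>

lemma second_difference_estimate:
  fixes f :: "'a::real_inner \<Rightarrow> real" and G A :: "'a \<Rightarrow> 'a"
  assumes f: "\<And>y. (f has_derivative (\<lambda>h. G y \<bullet> h)) (at y)"
    and A: "linear A"
    and G: "\<And>h. norm h \<le> norm u + norm v \<Longrightarrow> norm (G (x + h) - G x - A h) \<le> e * norm h"
    and e: "0 \<le> e"
  shows "\<bar>(f (x + u + v) - f (x + u) - f (x + v) + f x) - A v \<bullet> u\<bar>
           \<le> 2 * e * (norm u + norm v)\<^sup>2"
proof -
  define \<phi> where "\<phi> s = f (x + v + s *\<^sub>R u) - f (x + s *\<^sub>R u)" for s :: real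
  have line: "((\<lambda>s. f (y + s *\<^sub>R u)) has_derivative (\<lambda>r. G (y + s *\<^sub>R u) \<bullet> (r *\<^sub>R u))) (at s)" for y s
    by (rule has_derivative_compose[OF _ f]) (auto intro!: derivative_eq_intros)
  have "(\<phi> has_derivative (\<lambda>r. (G (x + v + s *\<^sub>R u) - G (x + s *\<^sub>R u)) \<bullet> (r *\<^sub>R u))) (at s within {0..1})"
    for s
    using has_derivative_diff[OF line[of "x + v" s] line[of x s]]
    unfolding \<phi>_def inner_diff_left by (rule has_derivative_at_withinI)
  from mvt_simple[OF zero_less_one this] obtain s where s: "0 < s" "s < 1"
    and mv: "\<phi> 1 - \<phi> 0 = (G (x + v + s *\<^sub>R u) - G (x + s *\<^sub>R u)) \<bullet> u"
    by auto
  define E where "E h = G (x + h) - G x - A h" for h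
  have su: "norm (s *\<^sub>R u) \<le> norm u" using s by (simp add: mult_left_le_one_le)
  have n1: "norm (v + s *\<^sub>R u) \<le> norm u + norm v" using norm_triangle_ineq[of v "s *\<^sub>R u"] su by simp
  have n2: "norm (s *\<^sub>R u) \<le> norm u + norm v" using su by (simp add: add_increasing2)
  have E1: "norm (E (v + s *\<^sub>R u)) \<le> e * (norm u + norm v)"
    using G[OF n1] mult_left_mono[OF n1 e] unfolding E_def by linarith
  have E2: "norm (E (s *\<^sub>R u)) \<le> e * (norm u + norm v)"
    using G[OF n2] mult_left_mono[OF n2 e] unfolding E_def by linarith
  have "G (x + v + s *\<^sub>R u) - G (x + s *\<^sub>R u) = E (v + s *\<^sub>R u) - E (s *\<^sub>R u) + A v"
    by (simp add: E_def linear_add[OF A] add.assoc)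
  then have "\<phi> 1 - \<phi> 0 - A v \<bullet> u = (E (v + s *\<^sub>R u) - E (s *\<^sub>R u)) \<bullet> u"
    by (simp add: mv inner_add_left)
  also have "\<bar>\<dots>\<bar> \<le> norm (E (v + s *\<^sub>R u) - E (s *\<^sub>R u)) * norm u"
    by (rule Cauchy_Schwarz_ineq2)
  also have "\<dots> \<le> (2 * e * (norm u + norm v)) * (norm u + norm v)"
    using norm_triangle_ineq4[of "E (v + s *\<^sub>R u)" "E (s *\<^sub>R u)"] E1 E2 e
    by (intro mult_mono) auto
  finally show ?thesis
    by (simp add: \<phi>_def algebra_simps power2_eq_square)
qed

lemma second_derivative_symmetric:
  fixes f :: "'a::real_inner \<Rightarrow> real" and G A :: "'a \<Rightarrow> 'a"
  assumes f: "\<And>y. (f has_derivative (\<lambda>h. G y \<bullet> h)) (at y)"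
    and G: "(G has_derivative A) (at x)"
  shows "A v \<bullet> u = A u \<bullet> v"
proof -
  have A: "linear A" using G by (rule has_derivative_linear)
  define c where "c = norm u + norm v"
  have c: "0 \<le> c" by (simp add: c_def)
  have bound: "\<bar>A v \<bullet> u - A u \<bullet> v\<bar> \<le> 4 * e * c\<^sup>2" if e: "e > 0" for e
  proof -
    from G[unfolded has_derivative_at_alt] e obtain \<delta> where \<delta>: "\<delta> > 0"
      and *: "\<And>y. norm (y - x) < \<delta> \<Longrightarrow> norm (G y - G x - A (y - x)) \<le> e * norm (y - x)"
      by blast
    define r where "r = \<delta> / (c + 1)"
    have r: "r > 0" and rc: "r * c < \<delta>" using \<delta> c by (auto simp: r_def field_simps)
    have loc: "norm (G (x + h) - G x - A h) \<le> e * norm h" if "norm h \<le> r * c" for h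
      using *[of "x + h"] that rc by simp
    let ?\<Delta> = "f (x + r *\<^sub>R u + r *\<^sub>R v) - f (x + r *\<^sub>R u) - f (x + r *\<^sub>R v) + f x"
    have n: "norm (r *\<^sub>R u) + norm (r *\<^sub>R v) = r * c" using r by (simp add: c_def algebra_simps)
    have "\<bar>?\<Delta> - A (r *\<^sub>R v) \<bullet> (r *\<^sub>R u)\<bar> \<le> 2 * e * (norm (r *\<^sub>R u) + norm (r *\<^sub>R v))\<^sup>2"
      by (intro second_difference_estimate[OF f A] loc) (use e n in simp_all)
    moreover have "\<bar>(f (x + r *\<^sub>R v + r *\<^sub>R u) - f (x + r *\<^sub>R v) - f (x + r *\<^sub>R u) + f x) - A (r *\<^sub>R u) \<bullet> (r *\<^sub>R v)\<bar>
        \<le> 2 * e * (norm (r *\<^sub>R v) + norm (r *\<^sub>R u))\<^sup>2"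
      by (intro second_difference_estimate[OF f A] loc) (use e n in simp_all)
    ultimately have "\<bar>?\<Delta> - r\<^sup>2 * (A v \<bullet> u)\<bar> \<le> 2 * e * (r * c)\<^sup>2" "\<bar>?\<Delta> - r\<^sup>2 * (A u \<bullet> v)\<bar> \<le> 2 * e * (r * c)\<^sup>2"
      by (simp_all only: n add.commute[of "norm (r *\<^sub>R v)"])
         (simp_all add: linear_cmul[OF A] power2_eq_square algebra_simps)
    then have "\<bar>r\<^sup>2 * (A v \<bullet> u) - r\<^sup>2 * (A u \<bullet> v)\<bar> \<le> 4 * e * (r * c)\<^sup>2" by linarith
    then have "\<bar>r\<^sup>2 * (A v \<bullet> u - A u \<bullet> v)\<bar> \<le> r\<^sup>2 * (4 * e * c\<^sup>2)"
      by (simp add: right_diff_distrib power_mult_distrib mult_ac)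
    then have "r\<^sup>2 * \<bar>A v \<bullet> u - A u \<bullet> v\<bar> \<le> r\<^sup>2 * (4 * e * c\<^sup>2)"
      by (simp only: abs_mult abs_power2)
    then show ?thesis using r by simp
  qed
  show ?thesis
  proof (rule ccontr)
    assume "A v \<bullet> u \<noteq> A u \<bullet> v"
    then have p: "\<bar>A v \<bullet> u - A u \<bullet> v\<bar> > 0" by simp
    define e where "e = \<bar>A v \<bullet> u - A u \<bullet> v\<bar> / (4 * (c\<^sup>2 + 1))"
    have c1: "4 * (c\<^sup>2 + 1) > 0" by (simp add: add_nonneg_pos)
    have e: "e > 0" using p c1 unfolding e_def by (rule divide_pos_pos)
    have "\<bar>A v \<bullet> u - A u \<bullet> v\<bar> = e * (4 * (c\<^sup>2 + 1))" using c1 by (simp add: e_def)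
    also have "\<dots> = 4 * e * c\<^sup>2 + 4 * e" by (simp add: algebra_simps)
    finally show False using bound[OF e] e by linarith
  qed
qed

lemma hess_symmetric:
  fixes f :: "real^'n \<Rightarrow> real"
  assumes "twice_continuously_differentiable f"
  shows "a \<bullet> (hess f x *v b) = b \<bullet> (hess f x *v a)"
  using second_derivative_symmetric[of f "grad f" "\<lambda>h. hess f x *v h" x b a]
    assms has_derivative_grad has_derivative_hess
  unfolding twice_continuously_differentiable_def by (metis inner_commute)

section \<open>The Lipschitz condition for long steps\<close>

text \<open>Testing the condition on a short multiple of \<open>d\<close> gives a nonnegative left-hand side.\<close>

lemma concordant_psd:
  fixes f :: "real^'n \<Rightarrow> real"
  assumes "concordant_lipschitz \<beta> f"
  shows "0 \<le> d \<bullet> (hess f x *v d)"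
proof -
  from assms obtain C where \<beta>: "\<beta> > 0" and C: "C > 0"
    and L: "\<And>x d. norm d \<le> C \<Longrightarrow>
        norm (grad f (x + d) - grad f x - hess f x *v d) \<le> \<beta> * (d \<bullet> (hess f x *v d))"
    unfolding concordant_lipschitz_def by blast
  define r where "r = C / (norm d + 1)"
  have r: "r > 0" using C by (simp add: r_def add_nonneg_pos)
  have "norm (r *\<^sub>R d) \<le> C"
    using C by (simp add: r_def add_nonneg_pos divide_simps distrib_left)
  from order_trans[OF norm_ge_zero L[OF this, of x]]
  have "0 \<le> \<beta> * (r * r * (d \<bullet> (hess f x *v d)))"
    by (simp add: matrix_vector_mult_scaleR mult_ac)
  then have "0 \<le> (\<beta> * (r * r)) * (d \<bullet> (hess f x *v d))" by (simp only: mult.assoc)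
  moreover have "0 < \<beta> * (r * r)" using \<beta> r by simp
  ultimately show ?thesis by (simp only: zero_le_mult_iff) linarith
qed

text \<open>A Gronwall inequality for finite increments. Cutting \<open>[0, s]\<close> into \<open>N\<close> pieces gives
  \<open>\<phi> s \<le> ((1 + K s/N) / (1 - K s/N))\<^sup>N \<phi> 0\<close>, and the factor tends to \<open>exp (2 K s)\<close>. Working
  with increments of \<open>\<phi>\<close> covers curvatures of a function that is only twice differentiable.\<close>

lemma gronwall_increments:
  fixes \<phi> :: "real \<Rightarrow> real"
  assumes step: "\<And>s \<sigma>. 0 \<le> \<sigma> \<Longrightarrow> \<sigma> \<le> \<delta> \<Longrightarrow> (1 - K * \<sigma>) * \<phi> (s + \<sigma>) \<le> (1 + K * \<sigma>) * \<phi> s"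
    and K: "0 \<le> K" and \<delta>: "0 < \<delta>" and s: "0 \<le> s"
  shows "\<phi> s \<le> exp (2 * K * s) * \<phi> 0"
proof -
  have cut: "(1 - K * s / real N) ^ N * \<phi> s \<le> (1 + K * s / real N) ^ N * \<phi> 0"
    if N: "real N > s / \<delta>" "real N > K * s" for N
  proof -
    define \<sigma> where "\<sigma> = s / real N"
    have N0: "real N > 0" using N(1) s \<delta> by (meson divide_nonneg_pos le_less_trans)
    have \<sigma>: "0 \<le> \<sigma>" "\<sigma> \<le> \<delta>" "K * \<sigma> \<le> 1"
      using N N0 s \<delta> by (auto simp: \<sigma>_def field_simps)
    have "(1 - K * \<sigma>) ^ i * \<phi> (real i * \<sigma>) \<le> (1 + K * \<sigma>) ^ i * \<phi> 0" for i
    proof (induction i)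
      case (Suc i)
      have "(1 - K * \<sigma>) ^ Suc i * \<phi> (real (Suc i) * \<sigma>)
          = (1 - K * \<sigma>) ^ i * ((1 - K * \<sigma>) * \<phi> (real i * \<sigma> + \<sigma>))"
        by (simp add: algebra_simps)
      also have "\<dots> \<le> (1 - K * \<sigma>) ^ i * ((1 + K * \<sigma>) * \<phi> (real i * \<sigma>))"
        using \<sigma> by (intro mult_left_mono step) auto
      also have "\<dots> = (1 + K * \<sigma>) * ((1 - K * \<sigma>) ^ i * \<phi> (real i * \<sigma>))" by simp
      also have "\<dots> \<le> (1 + K * \<sigma>) * ((1 + K * \<sigma>) ^ i * \<phi> 0)"
        using \<sigma> K by (intro mult_left_mono Suc.IH) auto
      finally show ?case by simp
    qed simp
    from this[of N] N0 show ?thesis by (simp add: \<sigma>_def)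
  qed
  have "eventually (\<lambda>N. real N > s / \<delta> \<and> real N > K * s) sequentially"
    by (intro eventually_conj filterlim_at_top_dense[THEN iffD1, rule_format] filterlim_real_sequentially)
  then have ev: "eventually (\<lambda>N. (1 + (- (K * s)) / real N) ^ N * \<phi> s \<le> (1 + K * s / real N) ^ N * \<phi> 0)
      sequentially"
    by eventually_elim (use cut in simp)
  have "exp (- (K * s)) * \<phi> s \<le> exp (K * s) * \<phi> 0"
    by (rule tendsto_le[OF sequentially_bot _ _ ev];
        intro tendsto_mult_right tendsto_exp_limit_sequentially)
  from mult_left_mono[OF this, of "exp (K * s)"]
  have "exp (K * s) * exp (- (K * s)) * \<phi> s \<le> exp (K * s) * exp (K * s) * \<phi> 0" by (simp add: mult.assoc)
  then show ?thesis by (simp only: exp_add[symmetric]) (simp add: algebra_simps)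
qed

text \<open>Applying the condition to the same short step from both of its ends, once forwards and once
  backwards, cancels the gradients and controls the change of the Hessian along the step. This
  bounds the curvature on the whole segment by the Gronwall inequality. The Taylor error of a long
  step is then collected over \<open>N\<close> pieces: the pieces' own errors contribute \<open>1/N\<close> and the drift
  of the Hessian \<open>(N-1)/N\<close> of the bound, so the sum does not depend on \<open>N\<close>.\<close>

lemma concordant_gradient_error:
  fixes f :: "real^'n \<Rightarrow> real"
  assumes "concordant_lipschitz \<beta> f"
  shows "norm (grad f (x + d) - grad f x - hess f x *v d)
           \<le> \<beta> * exp (2 * \<beta> * norm d) * (d \<bullet> (hess f x *v d))"
proof -
  from assms obtain C where \<beta>: "\<beta> > 0" and C: "C > 0"
    and L: "\<And>x d. norm d \<le> C \<Longrightarrow>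
        norm (grad f (x + d) - grad f x - hess f x *v d) \<le> \<beta> * (d \<bullet> (hess f x *v d))"
    unfolding concordant_lipschitz_def by blast
  define h where "h s = grad f (x + s *\<^sub>R d)" for s
  define w where "w s = hess f (x + s *\<^sub>R d) *v d" for s
  define \<phi> where "\<phi> s = d \<bullet> w s" for s
  define \<delta> where "\<delta> = C / (norm d + 1)"
  have \<delta>: "\<delta> > 0" using C by (simp add: \<delta>_def add_nonneg_pos)
  have piece: "norm (h (s + \<sigma>) - h s - \<sigma> *\<^sub>R w s) \<le> \<beta> * \<sigma>\<^sup>2 * \<phi> s" if "\<bar>\<sigma>\<bar> \<le> \<delta>" for s \<sigma>
  proof -
    have "norm (\<sigma> *\<^sub>R d) \<le> \<delta> * norm d" using that by (simp add: mult_right_mono)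
    also have "\<dots> \<le> C" using C by (simp add: \<delta>_def add_nonneg_pos divide_simps distrib_left)
    finally have "norm (\<sigma> *\<^sub>R d) \<le> C" .
    from L[OF this, of "x + s *\<^sub>R d"] show ?thesis
      by (simp add: h_def w_def \<phi>_def matrix_vector_mult_scaleR power2_eq_square algebra_simps)
  qed
  have drift: "norm (w (s + \<sigma>) - w s) \<le> \<beta> * \<sigma> * (\<phi> s + \<phi> (s + \<sigma>))" if \<sigma>: "0 \<le> \<sigma>" "\<sigma> \<le> \<delta>" for s \<sigma>
  proof (cases "\<sigma> = 0")
    case False
    have "\<sigma> * norm (w (s + \<sigma>) - w s) = norm (\<sigma> *\<^sub>R w (s + \<sigma>) - \<sigma> *\<^sub>R w s)"
      using \<sigma> by (simp add: scaleR_diff_right[symmetric])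
    also have "\<dots> = norm ((h (s + \<sigma>) - h s - \<sigma> *\<^sub>R w s)
        + (h (s + \<sigma> + - \<sigma>) - h (s + \<sigma>) - (- \<sigma>) *\<^sub>R w (s + \<sigma>)))"
      by (simp add: algebra_simps)
    also have "\<dots> \<le> \<beta> * \<sigma>\<^sup>2 * \<phi> s + \<beta> * (- \<sigma>)\<^sup>2 * \<phi> (s + \<sigma>)"
      using \<sigma> by (intro norm_triangle_mono piece) auto
    also have "\<dots> = \<sigma> * (\<beta> * \<sigma> * (\<phi> s + \<phi> (s + \<sigma>)))" by (simp add: power2_eq_square algebra_simps)
    finally show ?thesis using \<sigma> False by (simp add: mult_le_cancel_left)
  qed simp
  define M where "M = exp (2 * \<beta> * norm d)"
  have \<phi>0: "0 \<le> \<phi> 0" unfolding \<phi>_def w_def by (rule concordant_psd[OF assms])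
  have grow: "\<phi> s \<le> M * \<phi> 0" if s: "0 \<le> s" "s \<le> 1" for s
  proof -
    have "(1 - \<beta> * norm d * \<sigma>) * \<phi> (s + \<sigma>) \<le> (1 + \<beta> * norm d * \<sigma>) * \<phi> s" if "0 \<le> \<sigma>" "\<sigma> \<le> \<delta>" for s \<sigma>
    proof -
      have "\<phi> (s + \<sigma>) - \<phi> s = d \<bullet> (w (s + \<sigma>) - w s)" by (simp add: \<phi>_def inner_diff_right)
      also have "\<dots> \<le> norm d * norm (w (s + \<sigma>) - w s)" by (rule norm_cauchy_schwarz)
      also have "\<dots> \<le> norm d * (\<beta> * \<sigma> * (\<phi> s + \<phi> (s + \<sigma>)))"
        by (intro mult_left_mono drift that norm_ge_zero)
      finally show ?thesis by (simp add: algebra_simps)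
    qed
    then have "\<phi> s \<le> exp (2 * (\<beta> * norm d) * s) * \<phi> 0"
      by (rule gronwall_increments[where \<delta> = \<delta>]) (use \<beta> \<delta> s in auto)
    also have "\<dots> \<le> M * \<phi> 0"
      using \<phi>0 s \<beta> by (intro mult_right_mono) (auto simp: M_def mult_left_le)
    finally show ?thesis .
  qed
  obtain N where N: "N > 0" "1 / real N \<le> \<delta>"
    using real_arch_inverse[of \<delta>] \<delta> by (auto simp: inverse_eq_divide intro: less_imp_le)
  define \<sigma> where "\<sigma> = 1 / real N"
  have \<sigma>: "0 \<le> \<sigma>" "\<sigma> \<le> \<delta>" and N\<sigma>: "real N * \<sigma> = 1" using N by (auto simp: \<sigma>_def)
  have in01: "0 \<le> real i * \<sigma>" "real i * \<sigma> \<le> 1" if "i \<le> N" for i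
    using that \<sigma> N by (auto simp: \<sigma>_def)
  have wdrift: "norm (w (real i * \<sigma>) - w 0) \<le> real i * (2 * \<beta> * \<sigma> * (M * \<phi> 0))" if "i \<le> N" for i
    using that
  proof (induction i)
    case (Suc i)
    have "norm (w (real i * \<sigma> + \<sigma>) - w (real i * \<sigma>)) \<le> \<beta> * \<sigma> * (\<phi> (real i * \<sigma>) + \<phi> (real i * \<sigma> + \<sigma>))"
      by (rule drift[OF \<sigma>])
    also have "\<dots> \<le> \<beta> * \<sigma> * (M * \<phi> 0 + M * \<phi> 0)"
      using \<beta> \<sigma> grow[OF in01[of i]] grow[OF in01[of "Suc i"]] Suc.prems
      by (intro mult_left_mono add_mono) (auto simp: algebra_simps)
    finally have 1: "norm (w (real i * \<sigma> + \<sigma>) - w (real i * \<sigma>)) \<le> 2 * \<beta> * \<sigma> * (M * \<phi> 0)" by simp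
    have "norm (w (real (Suc i) * \<sigma>) - w 0)
        = norm ((w (real i * \<sigma> + \<sigma>) - w (real i * \<sigma>)) + (w (real i * \<sigma>) - w 0))"
      by (simp add: algebra_simps)
    also have "\<dots> \<le> 2 * \<beta> * \<sigma> * (M * \<phi> 0) + real i * (2 * \<beta> * \<sigma> * (M * \<phi> 0))"
      using 1 Suc by (intro norm_triangle_mono) auto
    finally show ?case by (simp add: algebra_simps)
  qed simp
  \<comment> \<open>The \<open>i\<close>-th piece adds \<open>2 i + 1\<close> units to the error, and these add up to \<open>i\<^sup>2\<close>.\<close>
  have "norm (h (real i * \<sigma>) - h 0 - (real i * \<sigma>) *\<^sub>R w 0) \<le> (real i)\<^sup>2 * (\<beta> * \<sigma>\<^sup>2 * (M * \<phi> 0))" if "i \<le> N" for i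
    using that
  proof (induction i)
    case (Suc i)
    let ?s = "real i * \<sigma>"
    have 1: "norm (h (?s + \<sigma>) - h ?s - \<sigma> *\<^sub>R w ?s) \<le> \<beta> * \<sigma>\<^sup>2 * (M * \<phi> 0)"
    proof (rule order_trans[OF piece])
      show "\<beta> * \<sigma>\<^sup>2 * \<phi> ?s \<le> \<beta> * \<sigma>\<^sup>2 * (M * \<phi> 0)"
        using \<beta> Suc.prems by (intro mult_left_mono grow in01) auto
    qed (use \<sigma> in simp)
    have 2: "norm (\<sigma> *\<^sub>R (w ?s - w 0)) \<le> \<sigma> * (real i * (2 * \<beta> * \<sigma> * (M * \<phi> 0)))"
      using wdrift[of i] \<sigma> Suc.prems by (simp add: mult_left_mono)
    have "norm (h (real (Suc i) * \<sigma>) - h 0 - (real (Suc i) * \<sigma>) *\<^sub>R w 0)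
        = norm ((h ?s - h 0 - ?s *\<^sub>R w 0) + ((h (?s + \<sigma>) - h ?s - \<sigma> *\<^sub>R w ?s) + \<sigma> *\<^sub>R (w ?s - w 0)))"
      by (simp add: algebra_simps)
    also have "\<dots> \<le> (real i)\<^sup>2 * (\<beta> * \<sigma>\<^sup>2 * (M * \<phi> 0))
        + (\<beta> * \<sigma>\<^sup>2 * (M * \<phi> 0) + \<sigma> * (real i * (2 * \<beta> * \<sigma> * (M * \<phi> 0))))"
      using 1 2 Suc by (intro norm_triangle_mono) auto
    also have "\<dots> = (real (Suc i))\<^sup>2 * (\<beta> * \<sigma>\<^sup>2 * (M * \<phi> 0))"
      by (simp add: power2_eq_square algebra_simps)
    finally show ?case .
  qed simp
  from this[of N] have "norm (h (real N * \<sigma>) - h 0 - (real N * \<sigma>) *\<^sub>R w 0)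
      \<le> (real N * \<sigma>)\<^sup>2 * (\<beta> * (M * \<phi> 0))"
    by (simp add: power_mult_distrib mult.assoc mult.left_commute)
  then show ?thesis by (simp add: N\<sigma> h_def w_def \<phi>_def M_def mult.assoc)
qed

section \<open>Solutions of the homogeneous model\<close>

text \<open>A negative minimum is attained on the sphere. Then \<open>A - m I\<close>, where \<open>m\<close> is the minimum, is
  positive semidefinite with a quadratic form vanishing at \<open>z\<close>, hence it annihilates \<open>z\<close>.\<close>

lemma unit_ball_minimizer_eigenvector:
  fixes A :: "'a::real_inner \<Rightarrow> 'a"
  assumes A: "linear A" and sym: "\<And>a b. a \<bullet> A b = b \<bullet> A a"
    and z: "norm z \<le> 1" and min: "\<And>w. norm w \<le> 1 \<Longrightarrow> z \<bullet> A z \<le> w \<bullet> A w"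
    and neg: "z \<bullet> A z < 0"
  shows "norm z = 1" and "A z = (z \<bullet> A z) *\<^sub>R z"
proof -
  define m where "m = z \<bullet> A z"
  have low: "m * (norm w)\<^sup>2 \<le> w \<bullet> A w" for w
  proof (cases "w = 0")
    case False
    have "m \<le> (w /\<^sub>R norm w) \<bullet> A (w /\<^sub>R norm w)"
      unfolding m_def by (rule min) (use False in simp)
    also have "\<dots> = (w \<bullet> A w) / (norm w)\<^sup>2"
      by (simp add: linear_cmul[OF A] power2_eq_square field_simps)
    finally show ?thesis using False by (simp add: field_simps)
  qed (simp add: linear_0[OF A])
  have "m * (norm z)\<^sup>2 \<le> m * 1" using low[of z] by (simp add: m_def)
  then have "(norm z)\<^sup>2 \<ge> 1" using neg by (simp add: m_def mult_le_cancel_left)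
  with z show n: "norm z = 1" by (smt (verit) norm_ge_zero power2_eq_square mult_left_le_one_le mult_right_le_one_le)
  define B where "B w = A w - m *\<^sub>R w" for w
  have Bpos: "0 \<le> w \<bullet> B w" for w
    using low[of w] by (simp add: B_def inner_diff_right power2_norm_eq_inner)
  have Bz: "z \<bullet> B z = 0"
    using n by (simp add: B_def inner_diff_right m_def norm_eq_1)
  have Bsym: "a \<bullet> B b = b \<bullet> B a" for a b
    by (simp add: B_def inner_diff_right sym[of a b] inner_commute[of a b])
  have Blin: "B (a + r *\<^sub>R b) = B a + r *\<^sub>R B b" for a b r
    by (simp add: B_def linear_add[OF A] linear_cmul[OF A] algebra_simps)
  define y where "y = B z"
  define q where "q = y \<bullet> B y"
  define c where "c = y \<bullet> y"
  have q: "0 \<le> q" unfolding q_def by (rule Bpos)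
  have quad: "0 \<le> 2 * r * c + r\<^sup>2 * q" for r
  proof -
    have "0 \<le> (z + r *\<^sub>R y) \<bullet> B (z + r *\<^sub>R y)" by (rule Bpos)
    also have "\<dots> = 2 * r * c + r\<^sup>2 * q"
      using Bz Bsym[of z y]
      by (simp add: Blin c_def q_def y_def[symmetric] inner_add_left inner_add_right
          power2_eq_square algebra_simps)
    finally show ?thesis .
  qed
  have "c = 0"
  proof (rule ccontr)
    assume "c \<noteq> 0"
    have "2 * (- c / (q + 1)) * c + (- c / (q + 1))\<^sup>2 * q = - (c / (q + 1))\<^sup>2 * (q + 2)"
      using q by (simp add: power2_eq_square divide_simps) (simp add: algebra_simps)
    moreover have "(c / (q + 1))\<^sup>2 * (q + 2) > 0" using q \<open>c \<noteq> 0\<close> by simp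
    ultimately show False using quad[of "- c / (q + 1)"] by simp
  qed
  then have "B z = 0" by (simp add: c_def y_def)
  then show "A z = (z \<bullet> A z) *\<^sub>R z" by (simp add: B_def m_def)
qed

text \<open>The point \<open>[0; 1]\<close> has objective value \<open>-\<mu>\<close>, hence \<open>\<theta> \<ge> \<mu>\<close>. If \<open>t\<close> vanished, the first block
  of the eigenvector equation would be \<open>H v = -\<theta> v\<close>; then \<open>v = 0\<close>, as \<open>H\<close> is positive
  semidefinite, although \<open>[v; t]\<close> has norm \<open>1\<close>.\<close>

lemma ghm_solution_newton_step:
  fixes H :: "real^'n^'n"
  assumes sym: "\<And>a b. a \<bullet> (H *v b) = b \<bullet> (H *v a)" and psd: "\<And>a. 0 \<le> a \<bullet> (H *v a)"
    and \<mu>: "\<mu> > 0" and sol: "ghm_solution H g \<mu> v t"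
  obtains \<theta> where "\<theta> \<ge> \<mu>" "H *v (v /\<^sub>R t) + \<theta> *\<^sub>R (v /\<^sub>R t) = - g" "g \<bullet> (v /\<^sub>R t) = \<mu> - \<theta>"
proof -
  define A where "A z = (H *v fst z + snd z *\<^sub>R g, g \<bullet> fst z - \<mu> * snd z)" for z :: "(real^'n) \<times> real"
  have obj: "ghm_objective H g \<mu> z = z \<bullet> A z" for z
    by (cases z) (simp add: ghm_objective_def A_def)
  have lin: "linear A"
    by (rule linearI)
       (auto simp: A_def matrix_vector_right_distrib matrix_vector_mult_scaleR inner_add_right algebra_simps)
  have Asym: "a \<bullet> A b = b \<bullet> A a" for a b
    using sym[of "fst a" "fst b"]
    by (simp add: A_def inner_prod_def inner_add_right inner_commute algebra_simps)
  from sol have nz: "norm (v, t) \<le> 1" and min: "\<And>w. norm w \<le> 1 \<Longrightarrow> (v, t) \<bullet> A (v, t) \<le> w \<bullet> A w"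
    unfolding ghm_solution_def is_arg_min_linorder obj by auto
  define \<theta> where "\<theta> = - ((v, t) \<bullet> A (v, t))"
  have \<theta>: "\<theta> \<ge> \<mu>"
    using min[of "(0, 1)"] by (simp add: \<theta>_def A_def norm_Pair)
  then have neg: "(v, t) \<bullet> A (v, t) < 0" using \<mu> by (simp add: \<theta>_def)
  note eig = unit_ball_minimizer_eigenvector[OF lin Asym nz min neg]
  from eig(2) have "A (v, t) = (- \<theta>) *\<^sub>R (v, t)" by (simp add: \<theta>_def)
  then have e1: "H *v v + t *\<^sub>R g = - (\<theta> *\<^sub>R v)" and e2: "g \<bullet> v - \<mu> * t = - (\<theta> * t)"
    by (auto simp: A_def)
  have t: "t \<noteq> 0"
  proof
    assume [simp]: "t = 0"
    have "0 \<le> - \<theta> * (v \<bullet> v)" using psd[of v] e1 by simp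
    then have "v \<bullet> v \<le> 0" using \<theta> \<mu> by (simp add: mult_le_0_iff zero_le_mult_iff)
    then have "v = 0" using inner_ge_zero[of v] by (simp add: order_antisym)
    then show False using eig(1) by (simp add: norm_Pair)
  qed
  show ?thesis
  proof
    show "\<theta> \<ge> \<mu>" by fact
    have "H *v (v /\<^sub>R t) + \<theta> *\<^sub>R (v /\<^sub>R t) = inverse t *\<^sub>R (H *v v + \<theta> *\<^sub>R v)"
      by (simp add: matrix_vector_mult_scaleR scaleR_add_right)
    also have "H *v v + \<theta> *\<^sub>R v = - (t *\<^sub>R g)" using e1 by (simp add: algebra_simps eq_neg_iff_add_eq_0)
    finally show "H *v (v /\<^sub>R t) + \<theta> *\<^sub>R (v /\<^sub>R t) = - g" using t by simp
    show "g \<bullet> (v /\<^sub>R t) = \<mu> - \<theta>" using e2 t by (simp add: field_simps)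
  qed
qed

section \<open>Quadratic decrease of the centering error\<close>

definition centering_error :: "real \<Rightarrow> (real^'n \<Rightarrow> real) \<Rightarrow> real \<Rightarrow> real^'n \<Rightarrow> real" where
  "centering_error \<beta> f \<mu> x = (\<beta> + 1) * norm (grad f x + \<mu> *\<^sub>R x) / \<mu>"

lemma approx_centered_iff_centering_error:
  assumes "\<beta> > 0" "\<mu> > 0"
  shows "approx_centered \<beta> f \<mu> x \<longleftrightarrow> centering_error \<beta> f \<mu> x \<le> (\<beta> + 1) / (1 + 3 * (\<beta> + 1))"
proof -
  define n where "n = norm (grad f x + \<mu> *\<^sub>R x)"
  have "(\<beta> + 1) * n / \<mu> \<le> (\<beta> + 1) / (1 + 3 * (\<beta> + 1)) \<longleftrightarrow>
        (\<beta> + 1) * (n / \<mu>) \<le> (\<beta> + 1) * (1 / (1 + 3 * (\<beta> + 1)))" by simp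
  also have "\<dots> \<longleftrightarrow> n / \<mu> \<le> 1 / (1 + 3 * (\<beta> + 1))"
    using assms by (intro mult_le_cancel_left_pos) simp
  also have "\<dots> \<longleftrightarrow> n \<le> \<mu> / (1 + 3 * (\<beta> + 1))"
    using assms by (simp add: field_simps)
  finally show ?thesis by (simp add: approx_centered_def centering_error_def n_def)
qed

lemma exp_four_thirds_le: "exp (4 / 3 :: real) \<le> 4"
proof (rule power_le_imp_le_base)
  have "exp (4 / 3 :: real) ^ Suc 2 = exp 1 ^ 4"
    by (simp add: exp_of_nat_mult[symmetric])
  also have "\<dots> \<le> (272 / 100) ^ 4" using e_less_272 by (intro power_mono) auto
  also have "\<dots> \<le> 4 ^ Suc 2" by (simp add: power_numeral_reduce)
  finally show "exp (4 / 3 :: real) ^ Suc 2 \<le> 4 ^ Suc 2" .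
qed simp

text \<open>With \<open>g\<close> the old residual and \<open>u = \<parallel>d\<parallel>\<close>, taking the inner product of
  \<open>(H + \<theta> I) d = -g\<close> with \<open>d\<close> gives \<open>\<theta> - \<mu> = d\<^sup>T H d + \<theta> u\<^sup>2 \<le> \<parallel>g\<parallel> u\<close>. Hence \<open>u \<le> \<parallel>g\<parallel> / \<mu>\<close> and
  \<open>d\<^sup>T H d \<le> \<parallel>g\<parallel> u - \<mu> u\<^sup>2 \<le> \<parallel>g\<parallel>\<^sup>2 / (4 \<mu>)\<close>. The new residual thus has norm at most
  \<open>\<beta> exp (2 \<beta> u) \<parallel>g\<parallel>\<^sup>2 / (4 \<mu>) + \<parallel>g\<parallel> u\<^sup>2\<close>, where the exponential is at most \<open>4\<close> and
  \<open>u\<^sup>2 \<le> u \<le> \<parallel>g\<parallel> / \<mu>\<close>.\<close>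

lemma centering_error_ghm_step:
  fixes f :: "real^'n \<Rightarrow> real"
  assumes f: "twice_continuously_differentiable f" and conc: "concordant_lipschitz \<beta> f"
    and \<beta>: "\<beta> > 0" and \<mu>: "\<mu> > 0"
    and sol: "ghm_solution (hess f x) (grad f x + \<mu> *\<^sub>R x) \<mu> v t"
    and small: "centering_error \<beta> f \<mu> x \<le> 2 / 3"
  shows "centering_error \<beta> f \<mu> (x + v /\<^sub>R t) \<le> (centering_error \<beta> f \<mu> x)\<^sup>2"
proof -
  define g where "g = grad f x + \<mu> *\<^sub>R x"
  define H where "H = hess f x"
  define d where "d = v /\<^sub>R t"
  define G where "G = norm g"
  define u where "u = norm d"
  obtain \<theta> where \<theta>: "\<theta> \<ge> \<mu>" and eq: "H *v d + \<theta> *\<^sub>R d = - g" and gd: "g \<bullet> d = \<mu> - \<theta>"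
    using ghm_solution_newton_step[OF hess_symmetric[OF f] concordant_psd[OF conc] \<mu> sol]
    unfolding g_def H_def d_def by blast
  have psd: "0 \<le> d \<bullet> (H *v d)" unfolding H_def by (rule concordant_psd[OF conc])
  have nonneg: "0 \<le> G" "0 \<le> u" by (auto simp: G_def u_def)
  have "d \<bullet> (H *v d) + \<theta> * u\<^sup>2 = d \<bullet> (H *v d + \<theta> *\<^sub>R d)"
    by (simp add: u_def inner_add_right power2_norm_eq_inner)
  then have D: "\<theta> - \<mu> = d \<bullet> (H *v d) + \<theta> * u\<^sup>2"
    using gd by (simp add: eq inner_commute)
  have DG: "\<theta> - \<mu> \<le> G * u"
    using Cauchy_Schwarz_ineq2[of g d] gd by (simp add: G_def u_def)
  have \<theta>u: "\<mu> * u\<^sup>2 \<le> \<theta> * u\<^sup>2" using \<theta> by (simp add: mult_right_mono)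
  have "\<mu> * u * u \<le> G * u" using D DG \<theta>u psd by (simp add: power2_eq_square)
  then have "\<mu> * u \<le> G" using nonneg by (cases "u = 0") (auto simp: mult_le_cancel_right)
  then have u: "u \<le> G / \<mu>" using \<mu> by (simp add: field_simps)
  have "d \<bullet> (H *v d) \<le> G * u - \<mu> * u\<^sup>2" using D DG \<theta>u by linarith
  also have "\<dots> = G\<^sup>2 / (4 * \<mu>) - \<mu> * (u - G / (2 * \<mu>))\<^sup>2"
    using \<mu> by (simp add: power2_eq_square field_simps)
  also have "\<dots> \<le> G\<^sup>2 / (4 * \<mu>)" using \<mu> by simp
  finally have curv: "d \<bullet> (H *v d) \<le> G\<^sup>2 / (4 * \<mu>)" .
  have e: "(\<beta> + 1) * (G / \<mu>) \<le> 2 / 3"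
    using small by (simp add: centering_error_def g_def G_def)
  have G\<mu>0: "0 \<le> G / \<mu>" using nonneg \<mu> by simp
  have \<beta>u: "\<beta> * u \<le> 2 / 3"
  proof -
    have "\<beta> * u \<le> \<beta> * (G / \<mu>)" using u \<beta> by (intro mult_left_mono) auto
    also have "\<dots> \<le> 2 / 3" using e G\<mu>0 unfolding distrib_right by linarith
    finally show ?thesis .
  qed
  have "G / \<mu> \<le> 2 / 3"
    using e mult_nonneg_nonneg[OF less_imp_le[OF \<beta>] G\<mu>0] unfolding distrib_right by linarith
  with u have u1: "u \<le> 1" by linarith
  have "exp (2 * \<beta> * u) \<le> exp (4 / 3)" using \<beta>u by simp
  then have exp4: "exp (2 * \<beta> * u) \<le> 4" using exp_four_thirds_le by linarith
  define R where "R = grad f (x + d) - grad f x - H *v d"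
  have "norm R \<le> \<beta> * exp (2 * \<beta> * u) * (d \<bullet> (H *v d))"
    unfolding R_def u_def H_def by (rule concordant_gradient_error[OF conc])
  also have "\<dots> \<le> \<beta> * 4 * (G\<^sup>2 / (4 * \<mu>))"
    using \<beta> exp4 curv psd \<mu> by (intro mult_mono) auto
  finally have R: "norm R \<le> \<beta> * (G\<^sup>2 / \<mu>)" by simp
  have "norm ((\<theta> - \<mu>) *\<^sub>R d) \<le> G * u * u"
    using DG \<theta> nonneg by (simp add: u_def[symmetric] mult_right_mono)
  also have "\<dots> \<le> G * u * 1" using u1 nonneg by (intro mult_left_mono) auto
  also have "\<dots> \<le> G * (G / \<mu>)" using u nonneg by (simp only: mult_1_right) (rule mult_left_mono)
  finally have S: "norm ((\<theta> - \<mu>) *\<^sub>R d) \<le> G\<^sup>2 / \<mu>" by (simp add: power2_eq_square)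
  have "H *v d = - g - \<theta> *\<^sub>R d" using eq by (simp add: eq_diff_eq)
  then have "grad f (x + d) + \<mu> *\<^sub>R (x + d) = R - (\<theta> - \<mu>) *\<^sub>R d"
    by (simp add: R_def g_def algebra_simps)
  then have "norm (grad f (x + d) + \<mu> *\<^sub>R (x + d)) \<le> \<beta> * (G\<^sup>2 / \<mu>) + G\<^sup>2 / \<mu>"
    using norm_triangle_ineq4[of R "(\<theta> - \<mu>) *\<^sub>R d"] R S by simp
  also have "\<dots> = (\<beta> + 1) * (G\<^sup>2 / \<mu>)" by (simp only: distrib_right mult_1)
  finally have "(\<beta> + 1) * norm (grad f (x + d) + \<mu> *\<^sub>R (x + d)) / \<mu> \<le> (\<beta> + 1) * ((\<beta> + 1) * (G\<^sup>2 / \<mu>)) / \<mu>"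
    using \<beta> \<mu> by (intro divide_right_mono mult_left_mono) auto
  also have "\<dots> = ((\<beta> + 1) * G / \<mu>)\<^sup>2" by (simp add: power2_eq_square)
  finally show ?thesis by (simp add: centering_error_def g_def G_def d_def)
qed

section \<open>Outer iterations\<close>

text \<open>With \<open>b = \<beta> + 1\<close> and \<open>s = 1 / (1 + \<parallel>x\<parallel>)\<close>, the scaled residual after the update is at most
  \<open>1/(1+3b) + s/(3b(1+3b)) + (1-s)/(3b)\<close>, where the last summand is the shift
  \<open>(\<mu> - \<mu>') \<parallel>x\<parallel> / \<mu>'\<close>. This decreases in \<open>s\<close> and stays below \<open>2/(3b)\<close>. The calculation
  clears denominators with \<open>c = 3b\<close> and \<open>p = c / s\<close>.\<close>

lemma centering_error_after_update:
  fixes f :: "real^'n \<Rightarrow> real"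
  assumes \<beta>: "\<beta> > 0" and \<mu>: "\<mu> > 0" and cent: "approx_centered \<beta> f \<mu> x"
  shows "centering_error \<beta> f (homotopy_ratio \<beta> x * \<mu>) x \<le> 2 / 3"
proof -
  define c where "c = 3 * (\<beta> + 1)"
  define r where "r = norm x"
  have c: "c > 3" and r: "r \<ge> 0" using \<beta> by (auto simp: c_def r_def)
  define p where "p = c * (1 + r)"
  have p: "p > 0" using c r by (simp add: p_def)
  have ratio: "homotopy_ratio \<beta> x = p / (1 + p)"
    by (simp add: homotopy_ratio_def p_def c_def r_def mult.assoc)
  define \<nu> where "\<nu> = p / (1 + p) * \<mu>"
  have \<nu>: "\<nu> > 0" using p \<mu> by (simp add: \<nu>_def)
  have diff: "\<mu> - \<nu> = \<mu> / (1 + p)" using p by (simp add: \<nu>_def field_simps)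
  have "grad f x + \<nu> *\<^sub>R x = (grad f x + \<mu> *\<^sub>R x) - (\<mu> - \<nu>) *\<^sub>R x" by (simp add: algebra_simps)
  then have "norm (grad f x + \<nu> *\<^sub>R x) \<le> norm (grad f x + \<mu> *\<^sub>R x) + norm ((\<mu> - \<nu>) *\<^sub>R x)"
    by (simp only: norm_triangle_ineq4)
  also have "\<dots> \<le> \<mu> / (1 + c) + \<mu> / (1 + p) * r"
    using cent p \<mu> unfolding approx_centered_def c_def[symmetric] diff by (simp add: r_def)
  also have "\<dots> \<le> \<mu> * (2 * (1 + r) / (1 + p))"
  proof -
    have "1 / (1 + c) + r / (1 + p) \<le> 2 * (1 + r) / (1 + p)"
    proof -
      have "1 + p \<le> (2 + r) * (1 + c)" using c r by (simp add: p_def algebra_simps)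
      then have "1 / (1 + c) \<le> (2 + r) / (1 + p)" using c p by (simp add: field_simps)
      then have "1 / (1 + c) + r / (1 + p) \<le> (2 + r) / (1 + p) + r / (1 + p)" by simp
      also have "\<dots> = 2 * (1 + r) / (1 + p)" by (simp add: add_divide_distrib[symmetric])
      finally show ?thesis .
    qed
    from mult_left_mono[OF this less_imp_le[OF \<mu>]] show ?thesis
      by (simp add: distrib_left)
  qed
  also have "1 + r = p / c" using c by (simp add: p_def)
  also have "\<mu> * (2 * (p / c) / (1 + p)) = \<nu> * (2 / c)" by (simp add: \<nu>_def mult_ac)
  finally have "norm (grad f x + \<nu> *\<^sub>R x) / \<nu> \<le> 2 / c" using \<nu> by (simp add: field_simps)
  from mult_left_mono[OF this, of "\<beta> + 1"] \<beta>
  have "(\<beta> + 1) * norm (grad f x + \<nu> *\<^sub>R x) / \<nu> \<le> (\<beta> + 1) * (2 / c)" by simp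
  also have "\<dots> = 2 / 3" using \<beta> by (simp add: c_def field_simps)
  finally show ?thesis by (simp add: centering_error_def ratio \<nu>_def)
qed

text \<open>Here \<open>2 (\<beta> + 1) / (1 + 3 (\<beta> + 1)) \<ge> 1/2\<close>, and \<open>\<parallel>g\<parallel> \<le> (1 + \<parallel>g\<parallel>\<^sup>2) / 2\<close>.\<close>

lemma approx_centered_initial:
  fixes f :: "real^'n \<Rightarrow> real"
  assumes "\<beta> > 0"
  shows "approx_centered \<beta> f (2 * (\<beta> + 1) * (1 + (norm (grad f 0))\<^sup>2)) 0"
proof -
  define n where "n = norm (grad f 0)"
  have "2 * n \<le> 1 + n\<^sup>2" using sum_squares_bound[of 1 n] by simp
  then have "2 * (\<beta> + 1) * (2 * n) \<le> 2 * (\<beta> + 1) * (1 + n\<^sup>2)" using assms by simp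
  moreover have "n * (1 + 3 * (\<beta> + 1)) \<le> n * (4 * (\<beta> + 1))"
    using assms by (intro mult_left_mono) (auto simp: n_def)
  ultimately have "n * (1 + 3 * (\<beta> + 1)) \<le> 2 * (\<beta> + 1) * (1 + n\<^sup>2)" by (simp add: mult_ac)
  then show ?thesis
    using assms by (simp add: approx_centered_def n_def[symmetric] pos_le_divide_eq)
qed

lemma iteration_bound_eq_2:
  assumes "\<beta> > (0::real)"
  shows "\<lceil>log 2 ((ln (1 + 3 * (\<beta> + 1)) - ln (\<beta> + 1)) / (ln 3 - ln 2))\<rceil> = 2"
proof -
  define q where "q = (1 + 3 * (\<beta> + 1)) / (\<beta> + 1)"
  define X where "X = ln q / ln (3 / 2)"
  have X: "(ln (1 + 3 * (\<beta> + 1)) - ln (\<beta> + 1)) / (ln 3 - ln 2) = X"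
    using assms by (simp add: X_def q_def ln_div)
  have q: "(3 / 2) ^ 2 < q" "q \<le> (3 / 2) ^ 4"
    using assms by (simp_all add: q_def power2_eq_square power_numeral_reduce field_simps)
  have pos: "ln (3 / 2 :: real) > 0" by simp
  have "ln ((3 / 2 :: real) ^ 2) < ln q" using q(1) by (subst ln_less_cancel_iff) (auto intro: less_trans[rotated])
  then have "2 * ln (3 / 2) < ln q" by (subst (asm) ln_realpow) auto
  then have X1: "2 < X" using pos by (simp add: X_def pos_less_divide_eq)
  have "ln q \<le> ln ((3 / 2 :: real) ^ 4)" using q by (subst ln_le_cancel_iff) (auto intro: less_trans[rotated])
  then have "ln q \<le> 4 * ln (3 / 2)" by (subst (asm) ln_realpow) auto
  then have X2: "X \<le> 4" using pos by (simp add: X_def pos_divide_le_eq)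
  have "1 < log 2 X" "log 2 X \<le> 2"
    using X1 X2 by (auto simp: less_log_iff log_le_iff)
  then show ?thesis unfolding X by (intro ceiling_unique) auto
qed

lemma inner_returns_at_first:
  assumes "approx_centered \<beta> f \<mu> (y n)"
  obtains j where "inner_returns_at \<beta> f \<mu> y j" "j \<le> n"
proof -
  let ?P = "\<lambda>j. approx_centered \<beta> f \<mu> (y j)"
  from that[of "LEAST j. ?P j"] show ?thesis
    unfolding inner_returns_at_def
    using LeastI[of ?P n] Least_le[of ?P n] assms not_less_Least[of _ ?P] by blast
qed

lemma inner_loop_returns_within_2:
  fixes f :: "real^'n \<Rightarrow> real"
  assumes f: "twice_continuously_differentiable f" "concordant_lipschitz \<beta> f"
    and \<beta>: "\<beta> > 0" and \<mu>: "\<mu> > 0" and start: "centering_error \<beta> f \<mu> (y 0) \<le> 2 / 3"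
    and run: "\<And>j. \<forall>i\<le>j. \<not> approx_centered \<beta> f \<mu> (y i) \<Longrightarrow>
        ghm_solution (hess f (y j)) (grad f (y j) + \<mu> *\<^sub>R y j) \<mu> (v j) (t j) \<and>
        y (Suc j) = y j + v j /\<^sub>R t j"
  obtains j where "inner_returns_at \<beta> f \<mu> y j" "j \<le> 2"
proof -
  let ?e = "\<lambda>j. centering_error \<beta> f \<mu> (y j)"
  have nonneg: "0 \<le> ?e j" for j using \<beta> \<mu> by (simp add: centering_error_def)
  have step: "?e (Suc j) \<le> (?e j)\<^sup>2" if "\<forall>i\<le>j. \<not> approx_centered \<beta> f \<mu> (y i)" "?e j \<le> 2 / 3" for j
    using centering_error_ghm_step[OF f \<beta> \<mu> _ that(2)] run[OF that(1)] by auto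
  have "\<exists>n\<le>2. approx_centered \<beta> f \<mu> (y n)"
  proof (rule ccontr)
    assume "\<not> ?thesis"
    then have no: "\<not> approx_centered \<beta> f \<mu> (y i)" if "i \<le> 2" for i using that by blast
    have "?e 1 \<le> (?e 0)\<^sup>2" using step[of 0] no start by simp
    also have "\<dots> \<le> (2 / 3)\<^sup>2" using start nonneg by (intro power_mono) auto
    finally have e1: "?e 1 \<le> (2 / 3)\<^sup>2" .
    also have "\<dots> \<le> 2 / 3" by (simp add: power2_eq_square)
    finally have "?e 2 \<le> (?e 1)\<^sup>2" using step[of 1] no by (simp add: numeral_2_eq_2)
    also have "\<dots> \<le> ((2 / 3)\<^sup>2)\<^sup>2" using e1 nonneg by (intro power_mono) auto
    also have "\<dots> \<le> 1 / 4" by (simp add: power2_eq_square)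
    also have "\<dots> \<le> (\<beta> + 1) / (1 + 3 * (\<beta> + 1))" using \<beta> by (simp add: field_simps)
    finally have "approx_centered \<beta> f \<mu> (y 2)"
      using approx_centered_iff_centering_error[OF \<beta> \<mu>] by blast
    then show False using no by simp
  qed
  then obtain n where "n \<le> 2" "approx_centered \<beta> f \<mu> (y n)" by blast
  with inner_returns_at_first that show thesis by (metis order_trans)
qed

theorem corollary4p3:
  fixes f :: "real^'n \<Rightarrow> real" and \<beta> :: real
    and x v :: "nat \<Rightarrow> nat \<Rightarrow> real^'n" and t :: "nat \<Rightarrow> nat \<Rightarrow> real"
    and \<mu> \<rho> :: "nat \<Rightarrow> real"
  assumes "\<beta> > 0"
    and "twice_continuously_differentiable f"
    and "concordant_lipschitz \<beta> f"
    and "homotopy_hsodm_run \<beta> f x v t \<mu> \<rho>"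
  shows "(\<forall>k\<ge>1. \<exists>j. inner_returns_at \<beta> f (\<mu> k) (x k) j \<and>
            int j \<le> \<lceil>log 2 ((ln (1 + 3 * (\<beta> + 1)) - ln (\<beta> + 1)) / (ln 3 - ln 2))\<rceil>) \<and>
         \<lceil>log 2 ((ln (1 + 3 * (\<beta> + 1)) - ln (\<beta> + 1)) / (ln 3 - ln 2))\<rceil> \<le> 2"
proof -
  note run = assms(4)[unfolded homotopy_hsodm_run_def]
  have x0: "x 0 0 = 0" and \<mu>0: "\<mu> 0 = 2 * (\<beta> + 1) * (1 + (norm (grad f 0))\<^sup>2)"
    using run by auto
  have model: "ghm_solution (hess f (x k j)) (grad f (x k j) + \<mu> k *\<^sub>R x k j) (\<mu> k) (v k j) (t k j) \<and>
      x k (Suc j) = x k j + v k j /\<^sub>R t k j" if "\<forall>i\<le>j. \<not> approx_centered \<beta> f (\<mu> k) (x k i)" for k j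
    using run that by blast
  have update: "\<mu> (Suc k) = homotopy_ratio \<beta> (x k j) * \<mu> k" "x (Suc k) 0 = x k j"
    if "inner_returns_at \<beta> f (\<mu> k) (x k) j" for k j
    using run that by metis+
  have start: "\<mu> (Suc k) > 0 \<and> centering_error \<beta> f (\<mu> (Suc k)) (x (Suc k) 0) \<le> 2 / 3"
    if j: "inner_returns_at \<beta> f (\<mu> k) (x k) j" and \<mu>: "\<mu> k > 0" for k j
  proof
    have "homotopy_ratio \<beta> (x k j) > 0"
      using assms(1) by (auto simp: homotopy_ratio_def intro!: divide_pos_pos mult_pos_pos add_pos_pos add_pos_nonneg)
    with \<mu> show "\<mu> (Suc k) > 0" by (simp add: update[OF j])
    show "centering_error \<beta> f (\<mu> (Suc k)) (x (Suc k) 0) \<le> 2 / 3"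
      using centering_error_after_update[OF assms(1) \<mu>, of f "x k j"] j
      by (simp add: update[OF j] inner_returns_at_def)
  qed
  have inner: "\<exists>j. inner_returns_at \<beta> f (\<mu> k) (x k) j \<and> j \<le> 2"
    if "\<mu> k > 0" "centering_error \<beta> f (\<mu> k) (x k 0) \<le> 2 / 3" for k
    using inner_loop_returns_within_2[of f \<beta> "\<mu> k" "x k" "v k" "t k"] assms(1-3) that model by blast
  have "inner_returns_at \<beta> f (\<mu> 0) (x 0) 0"
    using approx_centered_initial[OF assms(1)] by (simp add: inner_returns_at_def x0 \<mu>0)
  moreover have "\<mu> 0 > 0" using assms(1) by (simp add: \<mu>0 add_pos_nonneg)
  ultimately have first: "\<mu> (Suc 0) > 0 \<and> centering_error \<beta> f (\<mu> (Suc 0)) (x (Suc 0) 0) \<le> 2 / 3"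
    by (rule start)
  have all: "\<mu> (Suc k) > 0 \<and> centering_error \<beta> f (\<mu> (Suc k)) (x (Suc k) 0) \<le> 2 / 3" for k
  proof (induction k)
    case (Suc k)
    then show ?case using inner[of "Suc k"] start[of "Suc k"] by blast
  qed (rule first)
  have "\<exists>j. inner_returns_at \<beta> f (\<mu> k) (x k) j \<and> int j \<le> 2" if "k \<ge> 1" for k
    using inner[of k] all[of "k - 1"] that by force
  then show ?thesis unfolding iteration_bound_eq_2[OF assms(1)] by simp
qed

end
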